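(* Assume that $q$ is even. The number of good sets equals $$|\mathcal{I}|^{q+1}(q+1)!=\left(\frac{q-2}{2}\right)^{q+1}(q+1)!.$$
   Context: Let $q\ge4$ be a power of $2$. Let $\Lambda\subset\mathbb{F}_{q^2}\setminus\{0\}$ be a fixed set of $q-1$ elements with pairwise distinct norms $\alpha^{q+1}$, and $\mathcal{U}=\{u\in\mathbb{F}_{q^2}:u^{q+1}=1\}$. Fix $A=\{a_1,\dots,a_{(q-2)/2}\}\subset\mathbb{F}_q\setminus\{0\}$ such that $\{1\}\cup A\cup A^{-1}=\mathbb{F}_q\setminus\{0\}$ is a partition, where $A^{-1}=\{a^{-1}:a\in A\}$, and put $\mathcal{I}=\{\alpha\in\Lambda:\alpha^{q+1}\in A\}$, so $|\mathcal{I}|=(q-2)/2$. For $\alpha\in\mathcal{I}$, $u,v\in\mathcal{U}$, $P_{\alpha u}=(1,0,\alpha u,0)$ is a point of $\mathrm{PG}(3,q^2)$ and $\pi_{\alpha v}$ is the plane $X_4=\alpha vX_2$. A good set is a set $\mathcal{P}$ of $q+1$ pairs $(P_{\alpha_iu_i},\pi_{\alpha_iv_i})$, $\alpha_i\in\mathcal{I}$, $u_i,v_i\in\mathcal{U}$, such that any two members with $(\alpha_i,u_i,v_i)\ne(\alpha_j,u_j,v_j)$ satisfy $u_iv_j-v_iu_j\neq0$ and $\alpha_iu_i(\alpha_jv_j)^q-(\alpha_iv_i)^q\alpha_ju_j\neq0$. Equivalently, since the triple $(\alpha,u,v)$ is determined by the pair $(P_{\alpha u},\pi_{\alpha v})$,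 good sets may be counted as sets of $q+1$ triples. *)

theory Defs
  imports "HOL-Analysis.Analysis"
begin

text \<open>Throughout, the type \<open>'a\<close> plays the role of the field with \<open>q\<^sup>2\<close> elements; the subfield
  with \<open>q\<close> elements consists of the fixed points of \<open>x \<mapsto> x ^ q\<close>.\<close>

definition Fq :: "nat \<Rightarrow> ('a::{field,finite}) set" where
  "Fq q = {x. x ^ q = x}"

definition norm1 :: "nat \<Rightarrow> ('a::{field,finite}) set" where
  "norm1 q = {u. u ^ (q + 1) = 1}"

text \<open>Points and planes of the projective space \<open>PG(3, q\<^sup>2)\<close> are the subspaces of dimension one
  and three of \<open>'a ^ 4\<close>. The scalar \<open>b\<close> stands for \<open>\<alpha> * u\<close> in \<open>P\<^sub>\<alpha>\<^sub>u\<close> and for \<open>\<alpha> * v\<close>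
  in \<open>\<pi>\<^sub>\<alpha>\<^sub>v\<close>.\<close>

definition pt :: "'a::{field,finite} \<Rightarrow> ('a ^ 4) set" where
  "pt b = vec.span {vector [1, 0, b, 0]}"

definition plane :: "'a::{field,finite} \<Rightarrow> ('a ^ 4) set" where
  "plane b = {X. X $ 4 = b * X $ 2}"

text \<open>When the elements of \<open>I\<close> are nonzero and have pairwise distinct norms, a pair
  \<open>(pt (\<alpha> * u), plane (\<alpha> * v))\<close> determines \<open>(\<alpha>, u, v)\<close>, so quantifying over all triples that
  represent a member amounts to quantifying over the members.\<close>

definition good_set ::
  "nat \<Rightarrow> 'a::{field,finite} set \<Rightarrow> (('a ^ 4) set \<times> ('a ^ 4) set) set \<Rightarrow> bool" where
  "good_set q I S \<longleftrightarrow>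
     card S = q + 1 \<and>
     (\<forall>p\<in>S. \<exists>\<alpha>\<in>I. \<exists>u\<in>norm1 q. \<exists>v\<in>norm1 q. p = (pt (\<alpha> * u), plane (\<alpha> * v))) \<and>
     (\<forall>\<alpha>\<in>I. \<forall>u\<in>norm1 q. \<forall>v\<in>norm1 q. \<forall>\<alpha>'\<in>I. \<forall>u'\<in>norm1 q. \<forall>v'\<in>norm1 q.
        (pt (\<alpha> * u), plane (\<alpha> * v)) \<in> S \<longrightarrow>
        (pt (\<alpha>' * u'), plane (\<alpha>' * v')) \<in> S \<longrightarrow>
        (\<alpha>, u, v) \<noteq> (\<alpha>', u', v') \<longrightarrow>
        u * v' - v * u' \<noteq> 0 \<and>
        \<alpha> * u * (\<alpha>' * v') ^ q - (\<alpha> * v) ^ q * (\<alpha>' * u') \<noteq> 0)"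

end

theory Submission
  imports Defs
begin

text \<open>In the coordinates \<open>r = v / u\<close> and \<open>s = \<alpha> u v / \<alpha> ^ q\<close>, both of norm one, the two
  nonvanishing conditions say that distinct members differ in \<open>r\<close> and in \<open>s\<close>. The triple can be
  recovered from \<open>(\<alpha>, r, s)\<close> because squaring is injective on the group of norm one elements, whose
  order \<open>q + 1\<close> is odd. As a good set has exactly \<open>q + 1\<close> members, it is therefore the graph of a
  permutation \<open>r \<mapsto> s\<close> of this group together with an arbitrary labelling \<open>r \<mapsto> \<alpha>\<close>.\<close>

section \<open>Counting labelled graphs of permutations\<close>

lemma card_subsets_of_image:
  assumes "inj_on f B"
  shows "card {S. S \<subseteq> f ` B \<and> Q S} = card {R. R \<subseteq> B \<and> Q (f ` R)}"
proof -
  have "{S. S \<subseteq> f ` B \<and> Q S} = image f ` {R. R \<subseteq> B \<and> Q (f ` R)}"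
    by (auto simp: subset_image_iff)
  moreover have "inj_on (image f) {R. R \<subseteq> B \<and> Q (f ` R)}"
    using inj_on_image_Pow[OF assms] by (rule inj_on_subset) auto
  ultimately show ?thesis
    by (simp add: card_image)
qed

text \<open>Having \<open>card U\<close> elements, such an \<open>R\<close> projects bijectively
  onto \<open>U\<close> in its second entry, so the other two entries are functions of it.
  Injectivity in the third entry makes that function a permutation.\<close>

lemma card_labelled_permutation_graphs:
  assumes "finite U"
  shows "card {R. R \<subseteq> I \<times> U \<times> U \<and> card R = card U \<and>
           inj_on (\<lambda>(a, r, s). r) R \<and> inj_on (\<lambda>(a, r, s). s) R} =
         card I ^ card U * fact (card U)" (is "card ?X = _")
proof -
  let ?h = "\<lambda>(f, p). (\<lambda>r. (f r, r, p r)) ` U"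
  let ?D = "(U \<rightarrow>\<^sub>E I) \<times> {p. p permutes U}"
  have "bij_betw ?h ?D ?X"
    unfolding bij_betw_def
  proof (intro conjI subset_antisym subsetI)
    show "inj_on ?h ?D"
    proof (rule inj_onI, clarify, intro conjI)
      fix f p g p'
      assume f: "f \<in> U \<rightarrow>\<^sub>E I" and g: "g \<in> U \<rightarrow>\<^sub>E I" and p: "p permutes U" and p': "p' permutes U"
        and eq: "(\<lambda>r. (f r, r, p r)) ` U = (\<lambda>r. (g r, r, p' r)) ` U"
      have *: "f r = g r \<and> p r = p' r" if "r \<in> U" for r
      proof -
        have "(f r, r, p r) \<in> (\<lambda>r. (g r, r, p' r)) ` U"
          using that unfolding eq[symmetric] by blast
        then show ?thesis by auto
      qed
      \<comment> \<open>Agreement on \<open>U\<close> suffices: off \<open>U\<close>, extensional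
        functions are \<open>undefined\<close> and permutations of \<open>U\<close> are the
        identity.\<close>
      show "f = g"
        using * by (intro PiE_ext[OF f g]) auto
      show "p = p'"
        using * p p' by (metis ext permutes_not_in)
    qed
  next
    fix R assume "R \<in> ?h ` ?D"
    then obtain f p where f: "f \<in> U \<rightarrow>\<^sub>E I" and p: "p permutes U"
      and R: "R = (\<lambda>r. (f r, r, p r)) ` U" by auto
    have "card R = card U"
      unfolding R by (rule card_image) (auto intro: inj_onI)
    moreover have "inj_on (\<lambda>(a, r, s). s) R"
      using permutes_inj[OF p] by (auto simp: R inj_on_def inj_def)
    moreover have "inj_on (\<lambda>(a, r, s). r) R"
      by (auto simp: R inj_on_def)
    moreover have "R \<subseteq> I \<times> U \<times> U"
      using f p by (auto simp: R permutes_in_image)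
    ultimately show "R \<in> ?X" by blast
  next
    fix R assume "R \<in> ?X"
    then have sub: "R \<subseteq> I \<times> U \<times> U" and c: "card R = card U"
      and i1: "inj_on (\<lambda>(a, r, s). r) R" and i2: "inj_on (\<lambda>(a, r, s). s) R" by auto
    have sub': "fst t \<in> I" "snd (snd t) \<in> U" if "t \<in> R" for t
      using subsetD[OF sub that] by auto
    have im1: "(\<lambda>(a, r, s). r) ` R = U"
      using sub c assms by (intro card_subset_eq) (auto simp: card_image[OF i1])
    \<comment> \<open>\<open>g r\<close> is the one element of \<open>R\<close> with second entry
      \<open>r\<close>. The values of \<open>f\<close> and \<open>p\<close> off \<open>U\<close> are
      those that \<open>?D\<close> demands.\<close>
    define g where "g = inv_into R (\<lambda>(a, r, s). r)"
    define f where "f = restrict (\<lambda>r. fst (g r)) U"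
    define p where "p r = (if r \<in> U then snd (snd (g r)) else r)" for r
    have g: "g r \<in> R" "fst (snd (g r)) = r" if "r \<in> U" for r
      using that im1 inv_into_into[of r "\<lambda>(a, r, s). r" R]
        f_inv_into_f[of r "\<lambda>(a, r, s). r" R] by (auto simp: g_def split_beta)
    have fp: "(f r, r, p r) = g r" if "r \<in> U" for r
      using that g[OF that] by (auto simp: f_def p_def prod_eq_iff)
    have "R = (\<lambda>r. (f r, r, p r)) ` U"
    proof (intro subset_antisym subsetI)
      fix x assume x: "x \<in> R"
      then have r: "fst (snd x) \<in> U" using sub by auto
      have "g (fst (snd x)) = x"
        using g[OF r] x by (intro inj_onD[OF i1]) (simp_all add: split_beta)
      with fp[OF r] r show "x \<in> (\<lambda>r. (f r, r, p r)) ` U" by (metis (no_types, lifting) imageI)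
    next
      fix x assume "x \<in> (\<lambda>r. (f r, r, p r)) ` U"
      then show "x \<in> R" using fp g(1) by auto
    qed
    moreover have "f \<in> U \<rightarrow>\<^sub>E I"
      using sub'(1)[OF g(1)] by (auto simp: f_def)
    moreover have "p permutes U"
    proof (rule bij_imp_permutes)
      have "inj_on p U"
      proof (rule inj_onI)
        fix x y assume xy: "x \<in> U" "y \<in> U" "p x = p y"
        then have "g x = g y"
          using g(1) inj_onD[OF i2, of "g x" "g y"] by (auto simp: p_def split_beta)
        then show "x = y" using g(2) xy by metis
      qed
      moreover have "p ` U \<subseteq> U"
        using sub'(2)[OF g(1)] by (auto simp: p_def)
      ultimately show "bij_betw p U U"
        using endo_inj_surj[OF assms] by (simp add: bij_betw_def)
    qed (simp add: p_def)
    ultimately show "R \<in> ?h ` ?D" by (intro image_eqI[of _ _ "(f, p)"]) auto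
  qed
  then have "card ?X = card ?D"
    by (rule bij_betw_same_card[symmetric])
  then show ?thesis
    by (simp only: card_cartesian_product card_funcsetE[OF assms] card_permutations[OF refl assms])
qed

section \<open>Norms and elements of norm one\<close>

text \<open>Multiplication by a nonzero \<open>x\<close> permutes the nonzero elements, so their
  product is multiplied by \<open>x ^ card ?S\<close> and yet unchanged.\<close>

lemma power_card_field:
  fixes x :: "'a::{field,finite}"
  shows "x ^ CARD('a) = x"
proof (cases "x = 0")
  case False
  let ?S = "UNIV - {0::'a}"
  have bij: "bij_betw ((*) x) ?S ?S"
    using False by (intro bij_betw_byWitness[where f' = "\<lambda>y. y / x"]) auto
  have "prod id ?S = (\<Prod>y\<in>?S. x * y)"
    using prod.reindex_bij_betw[OF bij, of id] by simp
  also have "\<dots> = x ^ card ?S * prod id ?S"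
    by (simp add: prod.distrib)
  finally have "x ^ card ?S = 1"
    by auto
  moreover have "CARD('a) = Suc (card ?S)"
    using card_Suc_Diff1[of UNIV "0::'a"] by simp
  ultimately show ?thesis
    by (metis power_Suc mult_1_right)
qed simp

text \<open>Conjugation \<open>x \<mapsto> x ^ q\<close> is an involution here, so it merely swaps
  the two factors of the norm \<open>x * x ^ q\<close>.\<close>

lemma norm_in_Fq:
  fixes x :: "'a::{field,finite}"
  assumes "CARD('a) = q ^ 2"
  shows "x ^ (q + 1) \<in> Fq q"
proof -
  have "(x ^ (q + 1)) ^ q = x ^ (q ^ 2) * x ^ q"
    by (simp add: power_mult[symmetric] power_add[symmetric] power2_eq_square algebra_simps)
  also have "x ^ (q ^ 2) = x"
    using power_card_field[of x] assms by simp
  finally show ?thesis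
    by (simp add: Fq_def)
qed

text \<open>The elements are roots of \<open>X ^ q - X\<close>, which is nonzero because the two
  exponents differ.\<close>

lemma card_Fq_le:
  assumes "q \<ge> 2"
  shows "card (Fq q :: 'a::{field,finite} set) \<le> q"
proof -
  let ?p = "monom 1 q - monom 1 1 :: 'a poly"
  have "coeff ?p q = 1" using assms by simp
  then have nz: "?p \<noteq> 0" by (metis coeff_0 zero_neq_one)
  have "Fq q = {x. poly ?p x = 0}"
    by (auto simp: Fq_def poly_monom)
  also have "card \<dots> \<le> degree ?p"
    by (rule card_poly_roots_bound[OF nz])
  also have "\<dots> \<le> q"
    using assms by (intro degree_diff_le) (auto simp: degree_monom_eq)
  finally show ?thesis .
qed

lemma card_norm1_le: "card (norm1 q :: 'a::{field,finite} set) \<le> q + 1"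
proof -
  let ?p = "monom 1 (q + 1) - 1 :: 'a poly"
  have "coeff ?p (q + 1) = 1" by simp
  then have nz: "?p \<noteq> 0" by (metis coeff_0 zero_neq_one)
  have "norm1 q = {x. poly ?p x = 0}"
    by (auto simp: norm1_def poly_monom)
  also have "card \<dots> \<le> degree ?p"
    by (rule card_poly_roots_bound[OF nz])
  also have "\<dots> \<le> q + 1"
    by (intro degree_diff_le) (auto simp: degree_monom_eq)
  finally show ?thesis .
qed

text \<open>The norm maps the \<open>q ^ 2 - 1\<close> nonzero elements to at most
  \<open>q - 1\<close> values, and each fibre is a coset of \<open>norm1 q\<close>. This forces at
  least \<open>q + 1\<close> elements of norm one; the root bound gives the converse.\<close>

lemma card_norm1:
  assumes "CARD('a::{field,finite}) = q ^ 2" and "q \<ge> 2"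
  shows "card (norm1 q :: 'a set) = q + 1"
proof -
  let ?N = "\<lambda>x::'a. x ^ (q + 1)"
  let ?S = "UNIV - {0::'a}"
  let ?g = "inv_into ?S ?N"
  \<comment> \<open>\<open>?g y\<close> is a chosen nonzero element of norm \<open>y\<close>;
    dividing \<open>x\<close> by the one chosen for its own norm leaves an element of norm
    one.\<close>
  have "x \<in> (\<lambda>(y, u). ?g y * u) ` (?N ` ?S \<times> norm1 q)" if "x \<in> ?S" for x
  proof -
    have y: "?N x \<in> ?N ` ?S" using that by blast
    have "?g (?N x) \<noteq> 0" "?N (?g (?N x)) = ?N x"
      using inv_into_into[OF y] f_inv_into_f[OF y] by blast+
    then show ?thesis
      using that y
      by (intro image_eqI[of _ _ "(?N x, x / ?g (?N x))"]) (auto simp: norm1_def power_divide)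
  qed
  then have "card ?S \<le> card (?N ` ?S \<times> (norm1 q :: 'a set))"
    by (intro surj_card_le[OF _ subsetI]) auto
  also have "\<dots> = card (?N ` ?S) * card (norm1 q :: 'a set)"
    by (rule card_cartesian_product)
  also have "card (?N ` ?S) \<le> card (Fq q - {0::'a})"
    using norm_in_Fq[OF assms(1)] by (intro card_mono) auto
  also have "card (Fq q - {0::'a}) \<le> q - 1"
    using card_Fq_le[OF assms(2), where ?'a = 'a] assms(2)
    by (subst card_Diff_singleton) (auto simp: Fq_def)
  finally have "card ?S \<le> (q - 1) * card (norm1 q :: 'a set)" by simp
  moreover have "card ?S = (q - 1) * (q + 1)"
    using assms by (simp add: card_Diff_singleton power2_eq_square algebra_simps)
  ultimately have "(q - 1) * (q + 1) \<le> (q - 1) * card (norm1 q :: 'a set)" by simp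
  then have "q + 1 \<le> card (norm1 q :: 'a set)"
    by (rule mult_left_le_imp_le) (use assms(2) in simp)
  then show ?thesis
    using card_norm1_le[of q, where ?'a = 'a] by simp
qed

lemma norm1_nonzero: "u \<in> norm1 q \<Longrightarrow> u \<noteq> 0"
  by (auto simp: norm1_def)

text \<open>With \<open>q = 2 * k\<close> the equation \<open>(u ^ 2) ^ k * u = 1\<close> determines
  \<open>u\<close> from its square.\<close>

lemma inj_on_square_norm1:
  assumes "even q"
  shows "inj_on (\<lambda>u. u ^ 2) (norm1 q)"
proof (rule inj_onI)
  fix u v :: 'a
  assume u: "u \<in> norm1 q" and v: "v \<in> norm1 q" and eq: "u ^ 2 = v ^ 2"
  obtain k where k: "q = 2 * k" using assms by blast
  have "u ^ (q + 1) = v ^ (q + 1)" using u v by (simp add: norm1_def)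
  then have "(u ^ 2) ^ k * u = (v ^ 2) ^ k * v"
    unfolding k by (simp only: power_add power_mult power_one_right)
  then show "u = v"
    using norm1_nonzero[OF v] eq by simp
qed

section \<open>Point-plane pairs and their coordinates\<close>

lemma inj_pt: "inj (pt :: 'a::{field,finite} \<Rightarrow> ('a ^ 4) set)"
proof (rule injI)
  fix b c :: 'a
  assume "pt b = pt c"
  then have "vector [1, 0, b, 0] \<in> vec.span {vector [1, 0, c, 0] :: 'a ^ 4}"
    unfolding pt_def using vec.span_base by blast
  then obtain k where "vector [1, 0, b, 0] = k *s (vector [1, 0, c, 0] :: 'a ^ 4)"
    by (auto simp: vec.span_singleton)
  then have "(vector [1, 0, b, 0] :: 'a ^ 4) $ i = k * (vector [1, 0, c, 0] :: 'a ^ 4) $ i" for i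
    by (simp add: vec_eq_iff)
  \<comment> \<open>The first coordinate forces \<open>k = 1\<close>; the third then compares the
    scalars.\<close>
  from this[of 1] this[of 3] show "b = c" by (simp add: vector_def)
qed

lemma inj_plane: "inj (plane :: 'a::{field,finite} \<Rightarrow> ('a ^ 4) set)"
proof (rule injI)
  fix b c :: 'a
  assume "plane b = plane c"
  \<comment> \<open>With second coordinate 1, the fourth coordinate of a vector in the plane is the
    scalar itself.\<close>
  moreover have "vector [0, 1, 0, b] \<in> plane b" by (simp add: plane_def vector_def)
  ultimately have "vector [0, 1, 0, b] \<in> plane c" by simp
  then show "b = c" by (simp add: plane_def vector_def)
qed

text \<open>The point lies on the plane, since its second and fourth coordinates vanish; hence the
  name.\<close>

definition flag :: "'a::{field,finite} \<times> 'a \<times> 'a \<Rightarrow> ('a ^ 4) set \<times> ('a ^ 4) set" where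
  "flag = (\<lambda>(\<alpha>, u, v). (pt (\<alpha> * u), plane (\<alpha> * v)))"

text \<open>For \<open>v\<close> of norm one the last entry is
  \<open>\<alpha> * u / (\<alpha> * v) ^ q\<close>. Both ratios arise by separating the two members
  in the nonvanishing conditions.\<close>

definition coords :: "nat \<Rightarrow> 'a::{field,finite} \<times> 'a \<times> 'a \<Rightarrow> 'a \<times> 'a \<times> 'a" where
  "coords q = (\<lambda>(\<alpha>, u, v). (\<alpha>, v / u, \<alpha> * u * v / \<alpha> ^ q))"

text \<open>A factor of norm one leaves the norm unchanged, so \<open>\<alpha> * u\<close> reveals
  the norm of \<alpha> and thus \<alpha> itself; cancelling it recovers \<open>u\<close> and
  \<open>v\<close>.\<close>

lemma inj_on_flag:
  assumes "0 \<notin> I" and "inj_on (\<lambda>\<alpha>. \<alpha> ^ (q + 1)) I"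
  shows "inj_on flag (I \<times> norm1 q \<times> norm1 q)"
proof -
  have *: "\<alpha> = \<alpha>' \<and> u = u' \<and> v = v'"
    if I: "\<alpha> \<in> I" "\<alpha>' \<in> I" and U: "u \<in> norm1 q" "u' \<in> norm1 q"
    and eq: "flag (\<alpha>, u, v) = flag (\<alpha>', u', v')"
    for \<alpha> u v \<alpha>' u' v'
  proof -
  have uv: "\<alpha> * u = \<alpha>' * u'" "\<alpha> * v = \<alpha>' * v'"
    using eq injD[OF inj_pt] injD[OF inj_plane] by (auto simp: flag_def)
  have "(\<alpha> * u) ^ (q + 1) = (\<alpha>' * u') ^ (q + 1)"
    using uv by simp
  then have "\<alpha> ^ (q + 1) = \<alpha>' ^ (q + 1)"
    using U unfolding power_mult_distrib norm1_def by simp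
  then have "\<alpha> = \<alpha>'"
    using I inj_onD[OF assms(2)] by blast
  then show ?thesis
    using uv assms(1) I by auto
  qed
  show ?thesis
    by (rule inj_onI) (use * in fast)
qed

text \<open>Once \<alpha> is known, the last entry yields \<open>u * v\<close>; dividing by
  \<open>v / u\<close> gives \<open>u ^ 2\<close>, which determines \<open>u\<close>. Surjectivity
  follows because the map sends a finite set injectively into itself.\<close>

lemma bij_betw_coords:
  fixes I :: "'a::{field,finite} set"
  assumes "CARD('a) = q ^ 2" and "even q" and "0 \<notin> I"
  shows "bij_betw (coords q) (I \<times> norm1 q \<times> norm1 q) (I \<times> norm1 q \<times> norm1 q)"
proof -
  let ?T = "I \<times> norm1 q \<times> norm1 q"
  have *: "\<alpha> = \<alpha>' \<and> u = u' \<and> v = v'"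
    if I: "\<alpha> \<in> I" "\<alpha>' \<in> I" and U: "u \<in> norm1 q" "u' \<in> norm1 q"
      and V: "v \<in> norm1 q" "v' \<in> norm1 q"
      and eq: "coords q (\<alpha>, u, v) = coords q (\<alpha>', u', v')"
    for \<alpha> u v \<alpha>' u' v'
  proof -
    have a: "\<alpha> = \<alpha>'" and r: "v / u = v' / u'" and s: "\<alpha> * u * v / \<alpha> ^ q = \<alpha>' * u' * v' / \<alpha>' ^ q"
      using eq by (auto simp: coords_def)
    have nz: "\<alpha> \<noteq> 0" "u \<noteq> 0" "u' \<noteq> 0" "v \<noteq> 0" "v' \<noteq> 0"
      using assms(3) I U V norm1_nonzero by auto
    have uv: "u * v = u' * v'"
      using s a nz by simp
    have "u ^ 2 * (v / u) = u' ^ 2 * (v' / u')"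
      using uv nz by (simp add: power2_eq_square)
    then have "u ^ 2 = u' ^ 2"
      using r nz by simp
    then have "u = u'"
      using U inj_onD[OF inj_on_square_norm1[OF assms(2)]] by blast
    then show ?thesis
      using a uv nz by simp
  qed
  have inj: "inj_on (coords q) ?T"
    by (rule inj_onI) (use * in fast)
  have "coords q (\<alpha>, u, v) \<in> ?T"
    if I: "\<alpha> \<in> I" and U: "u \<in> norm1 q" and V: "v \<in> norm1 q" for \<alpha> u v
  proof -
    have nz: "\<alpha> \<noteq> 0" using assms(3) I by auto
    \<comment> \<open>\<alpha> and its conjugate \<open>\<alpha> ^ q\<close> have the same norm, so
      their quotient has norm one.\<close>
    have "(\<alpha> ^ (q + 1)) ^ q = \<alpha> ^ (q + 1)"
      using norm_in_Fq[OF assms(1), of \<alpha>] by (simp add: Fq_def)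
    then have "(\<alpha> ^ q) ^ (q + 1) = \<alpha> ^ (q + 1)"
      by (simp only: power_mult[symmetric] mult.commute)
    then have "(\<alpha> * u * v / \<alpha> ^ q) ^ (q + 1) = 1"
      using U V nz unfolding power_mult_distrib power_divide norm1_def by simp
    moreover have "(v / u) ^ (q + 1) = 1"
      using U V unfolding power_divide norm1_def by simp
    ultimately show ?thesis
      using I unfolding norm1_def coords_def prod.case by blast
  qed
  then have "coords q ` ?T \<subseteq> ?T"
    by (intro image_subsetI) (auto simp del: mem_Sigma_iff elim!: SigmaE)
  with inj show ?thesis
    by (simp add: bij_betw_def endo_inj_surj)
qed

section \<open>The pairwise conditions in coordinates\<close>

lemma nondegenerate_iff:
  assumes "u \<in> norm1 q" "v \<in> norm1 q" "u' \<in> norm1 q" "v' \<in> norm1 q" "\<alpha> \<noteq> 0" "\<alpha>' \<noteq> 0"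
  shows "u * v' - v * u' \<noteq> 0 \<longleftrightarrow> v / u \<noteq> v' / u'"
    and "\<alpha> * u * (\<alpha>' * v') ^ q - (\<alpha> * v) ^ q * (\<alpha>' * u') \<noteq> 0 \<longleftrightarrow>
         \<alpha> * u * v / \<alpha> ^ q \<noteq> \<alpha>' * u' * v' / \<alpha>' ^ q"
proof -
  have nz: "u \<noteq> 0" "v \<noteq> 0" "u' \<noteq> 0" "v' \<noteq> 0"
    using assms norm1_nonzero by auto
  show "u * v' - v * u' \<noteq> 0 \<longleftrightarrow> v / u \<noteq> v' / u'"
    using nz by (auto simp: field_simps)
  \<comment> \<open>Conjugation inverts elements of norm one.\<close>
  have "v ^ q = 1 / v" "v' ^ q = 1 / v'"
    using assms nz by (auto simp: norm1_def field_simps)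
  then have "\<alpha> * u * (\<alpha>' * v') ^ q - (\<alpha> * v) ^ q * (\<alpha>' * u') =
      \<alpha> * u * \<alpha>' ^ q / v' - \<alpha> ^ q * \<alpha>' * u' / v"
    by (simp add: power_mult_distrib)
  also have "\<dots> \<noteq> 0 \<longleftrightarrow> \<alpha> * u * v / \<alpha> ^ q \<noteq> \<alpha>' * u' * v' / \<alpha>' ^ q"
    using nz assms(5,6) by (auto simp: field_simps)
  finally show "\<alpha> * u * (\<alpha>' * v') ^ q - (\<alpha> * v) ^ q * (\<alpha>' * u') \<noteq> 0 \<longleftrightarrow>
      \<alpha> * u * v / \<alpha> ^ q \<noteq> \<alpha>' * u' * v' / \<alpha>' ^ q" .
qed

text \<open>\<open>flag\<close> and \<open>coords q\<close> are injective on the triples, so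
  cardinality and distinctness carry over. That distinct triples differ in both ratios is then
  injectivity of two projections.\<close>

lemma good_set_flag_iff:
  assumes "0 \<notin> I" and "inj_on (\<lambda>\<alpha>. \<alpha> ^ (q + 1)) I" and R: "R \<subseteq> I \<times> norm1 q \<times> norm1 q"
    and inj: "inj_on (coords q) (I \<times> norm1 q \<times> norm1 q)"
  shows "good_set q I (flag ` R) \<longleftrightarrow> card (coords q ` R) = q + 1 \<and>
    inj_on (\<lambda>(a, r, s). r) (coords q ` R) \<and> inj_on (\<lambda>(a, r, s). s) (coords q ` R)"
proof -
  let ?T = "I \<times> norm1 q \<times> norm1 q"
  let ?r = "\<lambda>(a, r, s). r" and ?s = "\<lambda>(a, r, s). s"
  let ?D = "\<lambda>t t'. ?r (coords q t) \<noteq> ?r (coords q t') \<and> ?s (coords q t) \<noteq> ?s (coords q t')"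
  note injf = inj_on_flag[OF assms(1,2)]
  have c: "card (flag ` R) = card (coords q ` R)"
    using inj_on_subset[OF injf R] inj_on_subset[OF inj R] by (simp add: card_image)
  have mem: "(pt (\<alpha> * u), plane (\<alpha> * v)) \<in> flag ` R \<longleftrightarrow> (\<alpha>, u, v) \<in> R"
    if "\<alpha> \<in> I" "u \<in> norm1 q" "v \<in> norm1 q" for \<alpha> u v
    using inj_on_image_mem_iff[OF injf, of "(\<alpha>, u, v)" R] that R by (simp add: flag_def)
  have repr: "\<forall>p\<in>flag ` R. \<exists>\<alpha>\<in>I. \<exists>u\<in>norm1 q. \<exists>v\<in>norm1 q. p = (pt (\<alpha> * u), plane (\<alpha> * v))"
    using R by (fastforce simp: flag_def)
  have D: "u * v' - v * u' \<noteq> 0 \<and> \<alpha> * u * (\<alpha>' * v') ^ q - (\<alpha> * v) ^ q * (\<alpha>' * u') \<noteq> 0 \<longleftrightarrow>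
      ?D (\<alpha>, u, v) (\<alpha>', u', v')"
    if "\<alpha> \<in> I" "u \<in> norm1 q" "v \<in> norm1 q" "\<alpha>' \<in> I" "u' \<in> norm1 q" "v' \<in> norm1 q"
    for \<alpha> u v \<alpha>' u' v'
  proof -
    have "\<alpha> \<noteq> 0" "\<alpha>' \<noteq> 0" using that assms(1) by auto
    then show ?thesis
      using nondegenerate_iff[of u q v u' v' \<alpha> \<alpha>'] that by (simp add: coords_def)
  qed
  \<comment> \<open>Members of \<open>R\<close> satisfy the six bounds automatically, so the
    quantifiers merge into two over \<open>R\<close>.\<close>
  have triples: "(\<forall>\<alpha>\<in>I. \<forall>u\<in>norm1 q. \<forall>v\<in>norm1 q. \<forall>\<alpha>'\<in>I. \<forall>u'\<in>norm1 q. \<forall>v'\<in>norm1 q.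
        (\<alpha>, u, v) \<in> R \<longrightarrow> (\<alpha>', u', v') \<in> R \<longrightarrow> (\<alpha>, u, v) \<noteq> (\<alpha>', u', v') \<longrightarrow>
        P (\<alpha>, u, v) (\<alpha>', u', v')) \<longleftrightarrow> (\<forall>t\<in>R. \<forall>t'\<in>R. t \<noteq> t' \<longrightarrow> P t t')"
    (is "?lhs \<longleftrightarrow> ?rhs") for P
  proof
    assume lhs: ?lhs
    show ?rhs
    proof (intro ballI impI)
      fix t t' assume t: "t \<in> R" "t' \<in> R" "t \<noteq> t'"
      obtain \<alpha> u v \<alpha>' u' v' where eq: "t = (\<alpha>, u, v)" "t' = (\<alpha>', u', v')"
        by (cases t, cases t')
      have "\<alpha> \<in> I" "u \<in> norm1 q" "v \<in> norm1 q" "\<alpha>' \<in> I" "u' \<in> norm1 q" "v' \<in> norm1 q"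
        using subsetD[OF R t(1)] subsetD[OF R t(2)] by (auto simp: eq)
      with lhs t show "P t t'" unfolding eq by blast
    qed
  qed simp
  have "good_set q I (flag ` R) \<longleftrightarrow> card (coords q ` R) = q + 1 \<and>
      (\<forall>\<alpha>\<in>I. \<forall>u\<in>norm1 q. \<forall>v\<in>norm1 q. \<forall>\<alpha>'\<in>I. \<forall>u'\<in>norm1 q. \<forall>v'\<in>norm1 q.
        (\<alpha>, u, v) \<in> R \<longrightarrow> (\<alpha>', u', v') \<in> R \<longrightarrow> (\<alpha>, u, v) \<noteq> (\<alpha>', u', v') \<longrightarrow>
        ?D (\<alpha>, u, v) (\<alpha>', u', v'))"
    unfolding good_set_def c using repr
    by (simp only: mem D cong: ball_cong) simp
  also have "\<dots> \<longleftrightarrow> card (coords q ` R) = q + 1 \<and> (\<forall>t\<in>R. \<forall>t'\<in>R. t \<noteq> t' \<longrightarrow> ?D t t')"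
    using triples[of ?D] by (rule conj_cong[OF refl])
  also have "\<dots> \<longleftrightarrow> card (coords q ` R) = q + 1 \<and> inj_on ?r (coords q ` R) \<and> inj_on ?s (coords q ` R)"
  proof -
    have "inj_on h (coords q ` R) \<longleftrightarrow> (\<forall>t\<in>R. \<forall>t'\<in>R. t \<noteq> t' \<longrightarrow> h (coords q t) \<noteq> h (coords q t'))"
      for h :: "'a \<times> 'a \<times> 'a \<Rightarrow> 'a"
      unfolding comp_inj_on_iff[OF inj_on_subset[OF inj R]] by (auto simp: inj_on_def)
    note this[of ?r] this[of ?s]
    then show ?thesis by (simp only:) blast
  qed
  finally show ?thesis .
qed

section \<open>The number of good sets\<close>

lemma card_good_sets:
  fixes I :: "'a::{field,finite} set"
  assumes "CARD('a) = q ^ 2" and "even q" and "q \<ge> 2"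
    and "0 \<notin> I" and "inj_on (\<lambda>\<alpha>. \<alpha> ^ (q + 1)) I"
  shows "card {S. good_set q I S} = card I ^ (q + 1) * fact (q + 1)"
proof -
  let ?T = "I \<times> norm1 q \<times> norm1 q :: ('a \<times> 'a \<times> 'a) set"
  let ?Q = "\<lambda>R::('a \<times> 'a \<times> 'a) set. card R = q + 1 \<and> inj_on (\<lambda>(a, r, s). r) R \<and> inj_on (\<lambda>(a, r, s). s) R"
  have inj: "inj_on (coords q) ?T" and im: "coords q ` ?T = ?T"
    using bij_betw_coords[OF assms(1,2,4)] by (auto simp: bij_betw_def)
  \<comment> \<open>Good sets are thus subsets of an injective image of the triples and can be
    counted as sets of triples.\<close>
  have "S \<subseteq> flag ` ?T" if "good_set q I S" for S
  proof
    fix p assume "p \<in> S"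
    then obtain \<alpha> u v where "\<alpha> \<in> I" "u \<in> norm1 q" "v \<in> norm1 q" "p = flag (\<alpha>, u, v)"
      using \<open>good_set q I S\<close> unfolding good_set_def flag_def by fastforce
    then show "p \<in> flag ` ?T" by blast
  qed
  then have "card {S. good_set q I S} = card {S. S \<subseteq> flag ` ?T \<and> good_set q I S}"
    by (metis (no_types, lifting))
  also have "\<dots> = card {R. R \<subseteq> ?T \<and> good_set q I (flag ` R)}"
    by (rule card_subsets_of_image[OF inj_on_flag[OF assms(4,5)]])
  also have "\<dots> = card {R. R \<subseteq> ?T \<and> ?Q (coords q ` R)}"
    using good_set_flag_iff[OF assms(4,5) _ inj] by (metis (no_types, lifting))
  \<comment> \<open>As \<open>coords q\<close> permutes \<open>?T\<close>, replacing
    \<open>R\<close> by its image keeps the same ambient set.\<close>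
  also have "\<dots> = card {R. R \<subseteq> ?T \<and> ?Q R}"
    using card_subsets_of_image[OF inj, of ?Q] unfolding im by simp
  also have "\<dots> = card I ^ (q + 1) * fact (q + 1)"
    using card_labelled_permutation_graphs[of "norm1 q :: 'a set" I, unfolded card_norm1[OF assms(1,3)]] by simp
  finally show ?thesis .
qed

text \<open>The norm takes \<open>q - 1\<close> distinct values on \<Lambda>, and
  \<open>Fq q\<close> has at most that many nonzero elements. So it maps \<Lambda> bijectively onto
  them, and \<open>A\<close> pulls back to a set of the same size.\<close>

lemma card_norm_preimage:
  fixes \<Lambda> A :: "'a::{field,finite} set"
  assumes "CARD('a) = q ^ 2" and "q \<ge> 2" and "0 \<notin> \<Lambda>" and "card \<Lambda> = q - 1"
    and inj: "inj_on (\<lambda>\<alpha>. \<alpha> ^ (q + 1)) \<Lambda>" and "A \<subseteq> Fq q - {0}"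
  shows "card {\<alpha> \<in> \<Lambda>. \<alpha> ^ (q + 1) \<in> A} = card A"
proof -
  let ?N = "\<lambda>\<alpha>::'a. \<alpha> ^ (q + 1)"
  have "?N ` \<Lambda> = Fq q - {0}"
  proof (rule card_seteq)
    show "?N ` \<Lambda> \<subseteq> Fq q - {0}"
      using norm_in_Fq[OF assms(1)] assms(3) by auto
    show "card (Fq q - {0 :: 'a}) \<le> card (?N ` \<Lambda>)"
      using card_Fq_le[OF assms(2), where ?'a = 'a] assms(2,4) unfolding card_image[OF inj]
      by (subst card_Diff_singleton) (auto simp: Fq_def)
  qed simp
  then have "?N ` {\<alpha> \<in> \<Lambda>. ?N \<alpha> \<in> A} = A"
    using assms(6) by auto
  moreover have "inj_on ?N {\<alpha> \<in> \<Lambda>. ?N \<alpha> \<in> A}"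
    using inj by (rule inj_on_subset) auto
  ultimately show ?thesis
    by (auto dest: card_image)
qed

theorem proposition4p5:
  fixes q :: nat and \<Lambda> A I :: "'a::{field,finite} set"
  assumes "q \<ge> 4" and "\<exists>k. q = 2 ^ k" and "CARD('a) = q ^ 2"
    and "\<Lambda> \<subseteq> UNIV - {0}" and "card \<Lambda> = q - 1" and "inj_on (\<lambda>\<alpha>. \<alpha> ^ (q + 1)) \<Lambda>"
    and "A \<subseteq> Fq q - {0}" and "card A = (q - 2) div 2"
    and "{1} \<union> A \<union> inverse ` A = Fq q - {0}"
    and "1 \<notin> A" and "1 \<notin> inverse ` A" and "A \<inter> inverse ` A = {}"
    and "I = {\<alpha> \<in> \<Lambda>. \<alpha> ^ (q + 1) \<in> A}"
  shows "card {S. good_set q I S} = card I ^ (q + 1) * fact (q + 1) \<and>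
         card I ^ (q + 1) * fact (q + 1) = ((q - 2) div 2) ^ (q + 1) * fact (q + 1)"
proof -
  \<comment> \<open>The only odd power of two is \<open>2 ^ 0\<close>, which
    \<open>q \<ge> 4\<close> excludes.\<close>
  have "even q"
    using assms(1,2) by (auto intro: ccontr)
  have "card {S. good_set q I S} = card I ^ (q + 1) * fact (q + 1)"
    using assms(1,3,4,6,13) \<open>even q\<close>
    by (intro card_good_sets inj_on_subset[OF assms(6)]) auto
  moreover have "card I = (q - 2) div 2"
    using assms(1,4) card_norm_preimage[OF assms(3) _ _ assms(5,6,7)]
    unfolding assms(13) assms(8)[symmetric] by auto
  ultimately show ?thesis by simp
qed

end
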